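(* Let $L\ge2$, and consider the Multi-level Parareal method (without averaging) with $L$ levels, whose coarse propagators $G^l$, $l=1,\dots,L-1$, satisfy for all $x,y$ $$\|\Phi^l(x)-G^l(x)\|\le C_{3,l}\Delta T_l^{p_l+1},\quad \|(\Phi^l-G^l)(x)-(\Phi^l-G^l)(y)\|\le C_{1,l}\Delta T_l^{p_l+1}\|x-y\|,\quad \|G^l(x)-G^l(y)\|\le(1+C_{2,l}\Delta T_l)\|x-y\|,$$ and whose finest propagator $P^0$ satisfies $\|\Phi^1(x)-P^0(x)\|\le c\,\Delta T_1\Delta T_0^{p_0}$ for all $x$. Set $$\alpha_l=C_{1,l}\Delta T_l^{p_l+1},\qquad \beta_l=1+C_{2,l}\Delta T_l,\qquad \gamma_l=C_{3,l}\Delta T_l^{p_l+1},\qquad \delta_0=c\,\Delta T_1\Delta T_0^{p_0}.$$ Then for every $l\in\{1,\dots,L-1\}$ and $1\le n\le N$ the error $e_{n,l}^{k_l}$ on level $l$ after $n$ time steps and $k_l$ Parareal iterations satisfies $$e_{n,l}^{k_l}\le\sum_{\bar l=1}^{l}E_{\bar l}\prod_{j=\bar l+1}^{l}A_j+\delta_0\prod_{\bar l=1}^{l}A_{\bar l},$$ where $$E_{l}=\binom{n}{k_l+1}\gamma_l\alpha_l^{k_l}\beta_l^{N-k_l-1},\qquad E_{\bar l}=\binom{N}{k_{\bar l}+1}\gamma_{\bar l}\alpha_{\bar l}^{k_{\bar l}}\beta_{\bar l}^{N-k_{\bar l}-1}\ (\bar l<l),\qquad A_{j}=N\beta_j^{N-1}(1+\alpha_{0N,j})^{N-1}$$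 for some numbers $\alpha_{0N,j}\in[0,\alpha_j]$.
   Context: A time-evolution ODE in a normed space is to be solved. Levels are numbered $0$ (finest) to $L-1$ (coarsest). The time steps are related by an integer coarsening factor $N\ge2$: $\Delta T_l=N^l\Delta T_0$; the grid on each level $l\ge1$ has $N$ steps of size $\Delta T_l$. $\Phi^l$ is the exact propagator of the problem over a time interval of length $\Delta T_l$, and $G^l$ is a numerical propagator doing one step of size $\Delta T_l$. $P^0$ is a numerical propagator over an interval of length $\Delta T_1$ using steps of size $\Delta T_0$. (Dependence of propagators on the starting time is suppressed; all estimates are uniform in it.) The numbers $k_l\ge0$ are the numbers of Parareal iterations on level $l$. The Multi-level Parareal method is defined recursively: for $l\ge1$ and a starting value $x$, the iterates on level $l$ are $U_{0,l}^k=x$, $U_{n,l}^0=G^l(U_{n-1,l}^0)$, and $$U_{n,l}^{k+1}=G^l(U_{n-1,l}^{k+1})+P^{l-1}(U_{n-1,l}^k)-G^l(U_{n-1,l}^k),\qquad 1\le n\le N,$$ and $P^l(x)=U_{N,l}^{k_l}$ (which advances over $N\Delta T_l=\Delta T_{l+1}$). The error $e_{n,l}^{k_l}$ is the supremum over starting values $x$ (and starting times) of the norm of the difference between the exact solution started at $x$ after time $n\Delta T_l$ and $U_{n,l}^{k_l}$. The $p_l$ are positive integers, $C_{i,l},c>0$ constants; empty products equal 1; $\binom{n}{m}=0$ for $m>n$. *)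

theory Defs
  imports "HOL-Analysis.Analysis"
begin

definition ode_solution ::
    "(real \<Rightarrow> 'a \<Rightarrow> 'a) \<Rightarrow> real set \<Rightarrow> real \<Rightarrow> 'a \<Rightarrow> (real \<Rightarrow> 'a::real_normed_vector) \<Rightarrow> bool"
  where "ode_solution f J s x u \<longleftrightarrow>
    u s = x \<and>
    (\<forall>t \<in> J \<inter> {s..}. (u has_vector_derivative f t (u t)) (at t within J \<inter> {s..}))"

text \<open>The initial value problem \<open>u' = f t u\<close>, \<open>u s = x\<close> has exactly one solution on
  \<open>J \<inter> {s..}\<close>. Functions are total, so uniqueness is required on that set only.\<close>

definition well_posed :: "(real \<Rightarrow> 'a \<Rightarrow> 'a::real_normed_vector) \<Rightarrow> real set \<Rightarrow> bool"
  where "well_posed f J \<longleftrightarrow>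
    (\<forall>s\<in>J. \<forall>x. (\<exists>u. ode_solution f J s x u) \<and>
      (\<forall>u v. ode_solution f J s x u \<longrightarrow> ode_solution f J s x v \<longrightarrow>
        (\<forall>t \<in> J \<inter> {s..}. u t = v t)))"

text \<open>\<open>exact f J s x t\<close> is the value at time \<open>t\<close> of the solution started at time \<open>s\<close> with
  value \<open>x\<close>. For well-posed problems it does not depend on the choice made by \<open>SOME\<close>
  as long as \<open>s \<in> J\<close> and \<open>t \<in> J \<inter> {s..}\<close>.\<close>

definition exact ::
    "(real \<Rightarrow> 'a \<Rightarrow> 'a) \<Rightarrow> real set \<Rightarrow> real \<Rightarrow> 'a \<Rightarrow> real \<Rightarrow> 'a::real_normed_vector"
  where "exact f J s x = (SOME u. ode_solution f J s x u)"

definition timestep :: "nat \<Rightarrow> real \<Rightarrow> nat \<Rightarrow> real"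
  where "timestep N \<Delta>T0 l = real N ^ l * \<Delta>T0"

text \<open>The exact propagator over a time interval of length \<open>timestep N \<Delta>T0 l\<close>, with its
  dependence on the starting time \<open>s\<close> made explicit.\<close>

definition exact_prop ::
    "(real \<Rightarrow> 'a \<Rightarrow> 'a) \<Rightarrow> real set \<Rightarrow> nat \<Rightarrow> real \<Rightarrow> nat \<Rightarrow> real \<Rightarrow> 'a \<Rightarrow> 'a::real_normed_vector"
  where "exact_prop f J N \<Delta>T0 l s x = exact f J s x (s + timestep N \<Delta>T0 l)"

text \<open>\<open>\<Theta> l\<close> is the set of starting times considered for propagation over an interval of length
  \<open>timestep N \<Delta>T0 l\<close> (for \<open>1 \<le> l \<le> L\<close>). Such an interval has to lie in the time domain
  \<open>J\<close>, and the \<open>N\<close> steps into which level \<open>l\<close> divides an interval of level \<open>l + 1\<close> have to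
  start at times in \<open>\<Theta> l\<close>. Both the choice of all \<open>s\<close> for which the interval lies in \<open>J\<close>
  and the choice of only the points of the nested grids on an interval \<open>J\<close> are instances.\<close>

definition start_times ::
    "real set \<Rightarrow> nat \<Rightarrow> real \<Rightarrow> nat \<Rightarrow> (nat \<Rightarrow> real set) \<Rightarrow> bool"
  where "start_times J N \<Delta>T0 L \<Theta> \<longleftrightarrow>
    (\<forall>l\<in>{1..L}. \<forall>s\<in>\<Theta> l. {s..s + timestep N \<Delta>T0 l} \<subseteq> J) \<and>
    (\<forall>l\<in>{1..<L}. \<forall>s\<in>\<Theta> (l + 1). \<forall>i<N. s + real i * timestep N \<Delta>T0 l \<in> \<Theta> l)"

text \<open>\<open>parareal G F h s x k n\<close> is the \<open>k\<close>-th Parareal iterate after \<open>n\<close> steps of size \<open>h\<close>,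
  started at time \<open>s\<close> with value \<open>x\<close>, for the coarse propagator \<open>G\<close> and the fine
  propagator \<open>F\<close>; the first argument of a propagator is its starting time.\<close>

fun parareal ::
    "(real \<Rightarrow> 'a \<Rightarrow> 'a) \<Rightarrow> (real \<Rightarrow> 'a \<Rightarrow> 'a) \<Rightarrow> real \<Rightarrow> real \<Rightarrow> 'a \<Rightarrow> nat \<Rightarrow> nat \<Rightarrow> 'a::real_normed_vector"
  where
    "parareal G F h s x k 0 = x"
  | "parareal G F h s x 0 (Suc n) = G (s + real n * h) (parareal G F h s x 0 n)"
  | "parareal G F h s x (Suc k) (Suc n) =
       G (s + real n * h) (parareal G F h s x (Suc k) n)
       + F (s + real n * h) (parareal G F h s x k n)
       - G (s + real n * h) (parareal G F h s x k n)"

text \<open>The propagator \<open>P\<^sup>l\<close> over an interval of length \<open>timestep N \<Delta>T0 (l + 1)\<close>. The values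
  \<open>G 0\<close> and \<open>k 0\<close> are not used.\<close>

primrec ml_prop ::
    "nat \<Rightarrow> real \<Rightarrow> (nat \<Rightarrow> nat) \<Rightarrow> (nat \<Rightarrow> real \<Rightarrow> 'a \<Rightarrow> 'a) \<Rightarrow> (real \<Rightarrow> 'a \<Rightarrow> 'a) \<Rightarrow>
     nat \<Rightarrow> real \<Rightarrow> 'a \<Rightarrow> 'a::real_normed_vector"
  where
    "ml_prop N \<Delta>T0 k G P0 0 = P0"
  | "ml_prop N \<Delta>T0 k G P0 (Suc l) = (\<lambda>s x.
       parareal (G (Suc l)) (ml_prop N \<Delta>T0 k G P0 l) (timestep N \<Delta>T0 (Suc l)) s x (k (Suc l)) N)"

text \<open>The iterate \<open>U\<close> on level \<open>l \<ge> 1\<close> after \<open>n\<close> steps and \<open>m\<close> iterations.\<close>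

definition ml_iterate ::
    "nat \<Rightarrow> real \<Rightarrow> (nat \<Rightarrow> nat) \<Rightarrow> (nat \<Rightarrow> real \<Rightarrow> 'a \<Rightarrow> 'a) \<Rightarrow> (real \<Rightarrow> 'a \<Rightarrow> 'a) \<Rightarrow>
     nat \<Rightarrow> real \<Rightarrow> 'a \<Rightarrow> nat \<Rightarrow> nat \<Rightarrow> 'a::real_normed_vector"
  where "ml_iterate N \<Delta>T0 k G P0 l s x m n =
    parareal (G l) (ml_prop N \<Delta>T0 k G P0 (l - 1)) (timestep N \<Delta>T0 l) s x m n"

text \<open>The supremum is taken in the extended reals, so that an upper bound by a real number
  includes its finiteness. A run on level \<open>l\<close> covers an interval of length
  \<open>timestep N \<Delta>T0 (l + 1)\<close>, hence the starting times in \<open>\<Theta> (l + 1)\<close>.\<close>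

definition ml_error ::
    "(real \<Rightarrow> 'a \<Rightarrow> 'a) \<Rightarrow> real set \<Rightarrow> (nat \<Rightarrow> real set) \<Rightarrow> nat \<Rightarrow> real \<Rightarrow> (nat \<Rightarrow> nat) \<Rightarrow>
     (nat \<Rightarrow> real \<Rightarrow> 'a \<Rightarrow> 'a) \<Rightarrow> (real \<Rightarrow> 'a \<Rightarrow> 'a::real_normed_vector) \<Rightarrow> nat \<Rightarrow> nat \<Rightarrow> ereal"
  where "ml_error f J \<Theta> N \<Delta>T0 k G P0 n l =
    (SUP (s, x) \<in> \<Theta> (l + 1) \<times> UNIV.
      ereal (norm (exact f J s x (s + real n * timestep N \<Delta>T0 l)
                   - ml_iterate N \<Delta>T0 k G P0 l s x (k l) n)))"

text \<open>The natural number subtraction in the exponent is harmless: for \<open>m \<le> N\<close> and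
  \<open>k \<ge> N\<close> the binomial coefficient is zero.\<close>

definition E_term :: "nat \<Rightarrow> nat \<Rightarrow> nat \<Rightarrow> real \<Rightarrow> real \<Rightarrow> real \<Rightarrow> real"
  where "E_term N m k \<alpha> \<beta> \<gamma> = real (m choose (k + 1)) * \<gamma> * \<alpha> ^ k * \<beta> ^ (N - k - 1)"

definition A_factor :: "nat \<Rightarrow> real \<Rightarrow> real \<Rightarrow> real"
  where "A_factor N \<beta> a = real N * \<beta> ^ (N - 1) * (1 + a) ^ (N - 1)"

end

theory Submission
  imports Defs
begin

text \<open>With \<open>e n k\<close> the error after \<open>n\<close> steps and \<open>k\<close> iterations on one level, and \<open>\<delta>\<close> the error
  of the fine propagator, the splitting
  \<open>\<Phi> u - U' = (G u - G U\<^sub>k\<^sub>+\<^sub>1) + ((\<Phi> - G) u - (\<Phi> - G) U\<^sub>k) + (\<Phi> U\<^sub>k - F U\<^sub>k)\<close>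
  gives \<open>e (n+1) (k+1) \<le> \<beta> e n (k+1) + \<alpha> e n k + \<delta>\<close>. By linearity the majorant splits into a part
  driven by \<open>\<gamma>\<close>, solved by Pascal's rule, and a part driven by \<open>\<delta>\<close>, at most
  \<open>\<delta> n (\<beta> (1 + \<alpha>)) ^ (n - 1)\<close> because \<open>\<beta> + \<alpha> \<le> \<beta> (1 + \<alpha>)\<close>. The bound for \<open>n = N\<close> on one level is
  the \<open>\<delta>\<close> of the next level. One can take \<open>\<alpha>\<^sub>0\<^sub>N = \<alpha>\<close>.\<close>

section \<open>Restarting exact solutions\<close>

lemma ode_solution_restart:
  assumes "ode_solution f J s x u" "s \<le> t"
  shows "ode_solution f J t (u t) u"
proof -
  have sub: "J \<inter> {t..} \<subseteq> J \<inter> {s..}" using assms(2) by auto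
  show ?thesis
    using assms(1) sub unfolding ode_solution_def
    by (meson has_vector_derivative_within_subset subsetD)
qed

lemma ode_solution_exact:
  assumes "well_posed f J" "s \<in> J"
  shows "ode_solution f J s x (exact f J s x)"
proof -
  have "\<exists>u. ode_solution f J s x u"
    using assms unfolding well_posed_def by blast
  then show ?thesis unfolding exact_def by (rule someI_ex)
qed

lemma exact_start:
  assumes "well_posed f J" "s \<in> J"
  shows "exact f J s x s = x"
  using ode_solution_exact[OF assms] unfolding ode_solution_def by blast

text \<open>Follows from uniqueness: from time \<open>t\<close> on, the solution started at
  \<open>s\<close> solves the restarted problem too. Uniqueness is only available on
  \<open>J\<close>, so \<open>t\<close> and \<open>r\<close> must lie there.\<close>

lemma exact_semigroup:
  assumes "well_posed f J" "s \<in> J" "t \<in> J" "s \<le> t" "r \<in> J" "t \<le> r"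
  shows "exact f J t (exact f J s x t) r = exact f J s x r"
proof -
  have "ode_solution f J t (exact f J s x t) (exact f J s x)"
    using ode_solution_restart[OF ode_solution_exact] assms by blast
  moreover have "ode_solution f J t (exact f J s x t) (exact f J t (exact f J s x t))"
    using ode_solution_exact assms by blast
  ultimately show ?thesis
    using assms unfolding well_posed_def by (metis IntI atLeast_iff)
qed

section \<open>Recurrences for the two parts of the majorant\<close>

text \<open>Both summands carry the same powers, so only the binomials add up. The exponent is tied
  to \<open>n\<close> to make this an equality. Where truncated subtraction would spoil the exponent
  of the first summand, its binomial vanishes.\<close>

lemma pascal_step:
  fixes \<alpha> \<beta> \<gamma> :: real
  shows "\<beta> * E_term n n (Suc k) \<alpha> \<beta> \<gamma> + \<alpha> * E_term n n k \<alpha> \<beta> \<gamma>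
       = E_term (Suc n) (Suc n) (Suc k) \<alpha> \<beta> \<gamma>"
proof (cases "n < k + 2")
  case True
  then have "n choose (Suc (Suc k)) = 0" by simp
  then show ?thesis by (simp add: E_term_def algebra_simps)
next
  case False
  then obtain m where "n = m + k + 2" by (metis add.assoc add.commute le_Suc_ex not_less)
  then show ?thesis by (simp add: E_term_def algebra_simps)
qed

text \<open>Passes from the exponent \<open>n - k - 1\<close> of the induction to the
  \<open>N - k - 1\<close> of the final bound, leaving the binomial alone.\<close>

lemma E_term_mono:
  assumes "n \<le> N" "0 \<le> \<alpha>" "1 \<le> \<beta>" "0 \<le> \<gamma>"
  shows "E_term n m k \<alpha> \<beta> \<gamma> \<le> E_term N m k \<alpha> \<beta> \<gamma>"
  unfolding E_term_def using assms by (intro mult_left_mono power_increasing) auto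

lemma A_factor_0: "A_factor 0 \<beta> \<alpha> = 0"
  by (simp add: A_factor_def)

lemma A_factor_nonneg:
  assumes "1 \<le> \<beta>" "0 \<le> \<alpha>"
  shows "0 \<le> A_factor n \<beta> \<alpha>"
  unfolding A_factor_def using assms by auto

lemma A_factor_mono:
  assumes "n \<le> N" "1 \<le> \<beta>" "0 \<le> \<alpha>"
  shows "A_factor n \<beta> \<alpha> \<le> A_factor N \<beta> \<alpha>"
  unfolding A_factor_def using assms by (intro mult_mono power_increasing) auto

text \<open>The recurrence \<open>d (n+1) = (\<beta> + \<alpha>) * d n + 1\<close> from 0 has a
  geometric sum as solution; \<open>A_factor\<close> is a supersolution, in effect \<open>n\<close>
  times a bound for the largest term.\<close>

lemma A_factor_step:
  fixes \<alpha> \<beta> :: real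
  assumes "1 \<le> \<beta>" "0 \<le> \<alpha>"
  shows "(\<beta> + \<alpha>) * A_factor n \<beta> \<alpha> + 1 \<le> A_factor (Suc n) \<beta> \<alpha>"
proof (cases n)
  case 0
  then show ?thesis by (simp add: A_factor_def)
next
  case (Suc m)
  have "\<beta> + \<alpha> \<le> \<beta> * (1 + \<alpha>)"
    using mult_right_mono[of 1 \<beta> \<alpha>] assms by (simp add: algebra_simps)
  then have "(\<beta> + \<alpha>) * A_factor n \<beta> \<alpha> \<le> \<beta> * (1 + \<alpha>) * A_factor n \<beta> \<alpha>"
    by (intro mult_right_mono A_factor_nonneg assms)
  also have "\<dots> = real n * (\<beta> ^ n * (1 + \<alpha>) ^ n)"
    by (simp add: A_factor_def Suc)
  finally have "(\<beta> + \<alpha>) * A_factor n \<beta> \<alpha> \<le> real n * (\<beta> ^ n * (1 + \<alpha>) ^ n)" .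
  moreover have "1 \<le> \<beta> ^ n * (1 + \<alpha>) ^ n"
    using mult_mono[of 1 "\<beta> ^ n" 1 "(1 + \<alpha>) ^ n"] assms by simp
  ultimately show ?thesis
    by (simp add: A_factor_def algebra_simps)
qed

section \<open>Error on a single level\<close>

text \<open>The splitting compares \<open>\<Phi>\<close> and \<open>F\<close> at the same point, so
  closeness of \<open>F\<close> to \<open>\<Phi>\<close> suffices and no Lipschitz bound on
  \<open>F\<close> is required. This allows the recursively defined propagator of the level below as
  \<open>F\<close>.\<close>

lemma parareal_error:
  fixes u :: "nat \<Rightarrow> 'a::real_normed_vector"
  assumes ab: "0 \<le> \<alpha>" "1 \<le> \<beta>" "0 \<le> \<gamma>" "0 \<le> \<delta>"
    and u0: "u 0 = x"
    and uS: "\<And>n. n < N \<Longrightarrow> u (Suc n) = \<Phi> (s + real n * h) (u n)"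
    and consistency: "\<And>n y. n < N \<Longrightarrow>
      norm (\<Phi> (s + real n * h) y - G (s + real n * h) y) \<le> \<gamma>"
    and defect: "\<And>n y z. n < N \<Longrightarrow>
      norm ((\<Phi> (s + real n * h) y - G (s + real n * h) y)
          - (\<Phi> (s + real n * h) z - G (s + real n * h) z)) \<le> \<alpha> * norm (y - z)"
    and lipschitz: "\<And>n y z. n < N \<Longrightarrow>
      norm (G (s + real n * h) y - G (s + real n * h) z) \<le> \<beta> * norm (y - z)"
    and fine: "\<And>n y. n < N \<Longrightarrow>
      norm (\<Phi> (s + real n * h) y - F (s + real n * h) y) \<le> \<delta>"
  shows "n \<le> N \<Longrightarrow>
    norm (u n - parareal G F h s x k n) \<le> E_term n n k \<alpha> \<beta> \<gamma> + \<delta> * A_factor n \<beta> \<alpha>"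
\<comment> \<open>\<open>k\<close> is generalized because iterate \<open>j + 1\<close> at step
  \<open>n + 1\<close> draws on iterates \<open>j + 1\<close> and \<open>j\<close> at step
  \<open>n\<close>.\<close>
proof (induction n arbitrary: k)
  case 0
  then show ?case by (simp add: u0 E_term_def A_factor_0)
next
  case (Suc n)
  then have n: "n < N" "n \<le> N" by auto
  note IH = Suc.IH[OF n(2)]
  define t where "t = s + real n * h"
  define d where "d = A_factor n \<beta> \<alpha>"
  define d' where "d' = A_factor (Suc n) \<beta> \<alpha>"
  have d0: "0 \<le> \<delta> * d" unfolding d_def using A_factor_nonneg ab by simp
  have "\<delta> * ((\<beta> + \<alpha>) * d + 1) \<le> \<delta> * d'"
    unfolding d_def d'_def by (intro mult_left_mono A_factor_step ab)
  then have dstep: "\<beta> * (\<delta> * d) + \<alpha> * (\<delta> * d) + \<delta> \<le> \<delta> * d'"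
    by (simp add: algebra_simps)
  show ?case
  proof (cases k)
    \<comment> \<open>The initial sweep uses \<open>G\<close> alone, so the recurrence is
      \<open>\<beta> * e + \<gamma>\<close>. Enlarging \<open>\<gamma>\<close> to
      \<open>\<gamma> * \<beta> ^ n\<close> gives the closed form; the \<open>\<delta>\<close> part
      only has slack.\<close>
    case 0
    let ?U = "parareal G F h s x 0 n"
    have "norm (u (Suc n) - parareal G F h s x 0 (Suc n))
        = norm ((G t (u n) - G t ?U) + (\<Phi> t (u n) - G t (u n)))"
      using uS n by (simp add: t_def)
    also have "\<dots> \<le> \<beta> * norm (u n - ?U) + \<gamma>"
      unfolding t_def by (intro norm_triangle_mono lipschitz consistency n)
    also have "\<dots> \<le> \<beta> * (E_term n n 0 \<alpha> \<beta> \<gamma> + \<delta> * d) + \<gamma>"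
      using IH[of 0] ab unfolding d_def by (intro add_mono mult_left_mono) auto
    also have "\<dots> \<le> E_term (Suc n) (Suc n) 0 \<alpha> \<beta> \<gamma> + \<delta> * d'"
    proof -
      have "\<beta> * E_term n n 0 \<alpha> \<beta> \<gamma> = real n * \<gamma> * \<beta> ^ n"
        by (cases n) (auto simp: E_term_def)
      moreover have "\<gamma> * 1 \<le> \<gamma> * \<beta> ^ n"
        using ab by (intro mult_left_mono) auto
      moreover have "E_term (Suc n) (Suc n) 0 \<alpha> \<beta> \<gamma> = real n * \<gamma> * \<beta> ^ n + \<gamma> * \<beta> ^ n"
        by (simp add: E_term_def algebra_simps)
      moreover have "0 \<le> \<alpha> * (\<delta> * d)" using d0 ab by simp
      ultimately show ?thesis using dstep ab by (simp add: distrib_left)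
    qed
    finally show ?thesis by (simp add: 0 d'_def)
  next
    case (Suc j)
    let ?U = "parareal G F h s x (Suc j) n" and ?V = "parareal G F h s x j n"
    have "norm (u (Suc n) - parareal G F h s x (Suc j) (Suc n))
        = norm (((G t (u n) - G t ?U)
          + ((\<Phi> t (u n) - G t (u n)) - (\<Phi> t ?V - G t ?V))) + (\<Phi> t ?V - F t ?V))"
      using uS n by (simp add: t_def algebra_simps)
    also have "\<dots> \<le> \<beta> * norm (u n - ?U) + \<alpha> * norm (u n - ?V) + \<delta>"
      unfolding t_def by (intro norm_triangle_mono lipschitz defect fine n)
    also have "\<dots> \<le> \<beta> * (E_term n n (Suc j) \<alpha> \<beta> \<gamma> + \<delta> * d)
        + \<alpha> * (E_term n n j \<alpha> \<beta> \<gamma> + \<delta> * d) + \<delta>"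
      using IH[of j] IH[of "Suc j"] ab unfolding d_def
      by (intro add_mono mult_left_mono) auto
    also have "\<dots> = E_term (Suc n) (Suc n) (Suc j) \<alpha> \<beta> \<gamma> + (\<beta> * (\<delta> * d) + \<alpha> * (\<delta> * d) + \<delta>)"
      unfolding pascal_step[symmetric] by (simp add: algebra_simps)
    also have "\<dots> \<le> E_term (Suc n) (Suc n) (Suc j) \<alpha> \<beta> \<gamma> + \<delta> * d'"
      using dstep by simp
    finally show ?thesis by (simp add: Suc d'_def)
  qed
qed

section \<open>Nested time grids and recursion over the levels\<close>

lemma timestep_Suc: "timestep N T (Suc l) = real N * timestep N T l"
  by (simp add: timestep_def)

text \<open>A run on level \<open>l\<close> fills one interval of level \<open>l + 1\<close>, which
  \<open>start_times\<close> places inside \<open>J\<close>; hence all its grid points are in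
  \<open>J\<close> and the semigroup law applies.\<close>

lemma exact_grid_step:
  assumes wp: "well_posed f J" and st: "start_times J N T L \<Theta>"
    and T: "0 \<le> T" and l: "l \<in> {1..<L}" and s: "s \<in> \<Theta> (l + 1)" and n: "n < N"
  shows "exact f J s x (s + real (Suc n) * timestep N T l)
       = exact_prop f J N T l (s + real n * timestep N T l)
           (exact f J s x (s + real n * timestep N T l))"
proof -
  define h where "h = timestep N T l"
  have h: "0 \<le> h" using T by (simp add: h_def timestep_def)
  have "l + 1 \<in> {1..L}" using l by auto
  then have sub: "{s..s + real N * h} \<subseteq> J"
    using st s unfolding start_times_def h_def by (metis Suc_eq_plus1 timestep_Suc)
  have J: "s + real m * h \<in> J" if "m \<le> N" for m
    using sub h that by (auto intro!: mult_right_mono subsetD[OF sub])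
  have "exact f J (s + real n * h) (exact f J s x (s + real n * h)) (s + real (Suc n) * h)
      = exact f J s x (s + real (Suc n) * h)"
    using J[of 0] J[of n] J[of "Suc n"] n h
    by (intro exact_semigroup[OF wp]) (auto simp: algebra_simps)
  then show ?thesis
    by (simp add: exact_prop_def h_def algebra_simps)
qed

theorem theorem3p4:
  fixes f :: "real \<Rightarrow> 'a \<Rightarrow> 'a::real_normed_vector"
    and J :: "real set" and \<Theta> :: "nat \<Rightarrow> real set"
    and N L :: nat and \<Delta>T0 c \<delta>0 :: real
    and G :: "nat \<Rightarrow> real \<Rightarrow> 'a \<Rightarrow> 'a" and P0 :: "real \<Rightarrow> 'a \<Rightarrow> 'a"
    and k p :: "nat \<Rightarrow> nat"
    and C1 C2 C3 \<alpha> \<beta> \<gamma> :: "nat \<Rightarrow> real"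
  defines "\<Delta>T \<equiv> timestep N \<Delta>T0"
    and "\<Phi> \<equiv> exact_prop f J N \<Delta>T0"
  assumes "L \<ge> 2" and "N \<ge> 2" and "\<Delta>T0 > 0"
    and "is_interval J" and "well_posed f J"
    and "start_times J N \<Delta>T0 L \<Theta>"
    and "\<And>l. l \<in> {0..<L} \<Longrightarrow> p l > 0"
    and "\<And>l. l \<in> {1..<L} \<Longrightarrow> C1 l > 0 \<and> C2 l > 0 \<and> C3 l > 0" and "c > 0"
    and "\<And>l s x. l \<in> {1..<L} \<Longrightarrow> s \<in> \<Theta> l \<Longrightarrow>
           norm (\<Phi> l s x - G l s x) \<le> C3 l * \<Delta>T l ^ (p l + 1)"
    and "\<And>l s x y. l \<in> {1..<L} \<Longrightarrow> s \<in> \<Theta> l \<Longrightarrow>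
           norm ((\<Phi> l s x - G l s x) - (\<Phi> l s y - G l s y))
             \<le> C1 l * \<Delta>T l ^ (p l + 1) * norm (x - y)"
    and "\<And>l s x y. l \<in> {1..<L} \<Longrightarrow> s \<in> \<Theta> l \<Longrightarrow>
           norm (G l s x - G l s y) \<le> (1 + C2 l * \<Delta>T l) * norm (x - y)"
    and "\<And>s x. s \<in> \<Theta> 1 \<Longrightarrow> norm (\<Phi> 1 s x - P0 s x) \<le> c * \<Delta>T 1 * \<Delta>T 0 ^ p 0"
    and "\<And>l. \<alpha> l = C1 l * \<Delta>T l ^ (p l + 1)"
    and "\<And>l. \<beta> l = 1 + C2 l * \<Delta>T l"
    and "\<And>l. \<gamma> l = C3 l * \<Delta>T l ^ (p l + 1)"
    and "\<delta>0 = c * \<Delta>T 1 * \<Delta>T 0 ^ p 0"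
  shows "\<exists>\<alpha>0N :: nat \<Rightarrow> real.
    (\<forall>j\<in>{1..<L}. \<alpha>0N j \<in> {0..\<alpha> j}) \<and>
    (\<forall>l\<in>{1..<L}. \<forall>n\<in>{1..N}.
      ml_error f J \<Theta> N \<Delta>T0 k G P0 n l \<le>
        ereal ((\<Sum>i=1..l. E_term N (if i = l then n else N) (k i) (\<alpha> i) (\<beta> i) (\<gamma> i)
                            * (\<Prod>j=i+1..l. A_factor N (\<beta> j) (\<alpha>0N j)))
               + \<delta>0 * (\<Prod>j=1..l. A_factor N (\<beta> j) (\<alpha>0N j))))"
proof -
  note L = assms(3) and N = assms(4) and T0 = assms(5) and wp = assms(7) and st = assms(8)
    and C = assms(10) and c = assms(11) and cons = assms(12) and def = assms(13)
    and lip = assms(14) and fine0 = assms(15) and \<alpha> = assms(16) and \<beta> = assms(17)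
    and \<gamma> = assms(18) and \<delta> = assms(19)
  have \<Delta>T: "0 < \<Delta>T l" for l using N T0 by (simp add: \<Delta>T_def timestep_def)
  have ab: "0 \<le> \<alpha> l" "1 \<le> \<beta> l" "0 \<le> \<gamma> l" if "l \<in> {1..<L}" for l
    using C[OF that] \<Delta>T[of l] by (auto simp: \<alpha> \<beta> \<gamma>)
  have \<delta>0: "0 \<le> \<delta>0" using c \<Delta>T[of 0] \<Delta>T[of 1] by (simp add: \<delta>)
  \<comment> \<open>The claimed bound with witness \<open>\<alpha>\<close>. For \<open>l = 0\<close>
    the sum and the product are empty and \<open>\<delta>0\<close> remains.\<close>
  define R where "R l n =
    (\<Sum>i=1..l. E_term N (if i = l then n else N) (k i) (\<alpha> i) (\<beta> i) (\<gamma> i)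
                            * (\<Prod>j=i+1..l. A_factor N (\<beta> j) (\<alpha> j)))
               + \<delta>0 * (\<Prod>j=1..l. A_factor N (\<beta> j) (\<alpha> j))" for l n
  \<comment> \<open>The top summand alone sees \<open>n\<close>. Every lower one has
    \<open>N\<close> and gains one factor, which leaves \<open>R l N\<close> as the fine error
    \<open>\<delta>\<close> of level \<open>Suc l\<close>.\<close>
  have R_Suc: "R (Suc l) n = E_term N n (k (Suc l)) (\<alpha> (Suc l)) (\<beta> (Suc l)) (\<gamma> (Suc l))
      + R l N * A_factor N (\<beta> (Suc l)) (\<alpha> (Suc l))" for l n
  proof -
    let ?A = "\<lambda>j. A_factor N (\<beta> j) (\<alpha> j)"
    have "(\<Sum>i=1..l. E_term N (if i = Suc l then n else N) (k i) (\<alpha> i) (\<beta> i) (\<gamma> i)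
          * (\<Prod>j=i+1..Suc l. ?A j))
        = (\<Sum>i=1..l. E_term N (if i = l then N else N) (k i) (\<alpha> i) (\<beta> i) (\<gamma> i)
          * (\<Prod>j=i+1..l. ?A j)) * ?A (Suc l)"
      unfolding sum_distrib_right by (intro sum.cong refl) auto
    then show ?thesis by (simp add: R_def algebra_simps)
  qed
  define P where "P = ml_prop N \<Delta>T0 k G P0"
  have level: "norm (exact f J s x (s + real n * \<Delta>T (Suc l))
        - parareal (G (Suc l)) (P l) (\<Delta>T (Suc l)) s x (k (Suc l)) n) \<le> R (Suc l) n"
    if fine: "\<And>s x. s \<in> \<Theta> (Suc l) \<Longrightarrow> norm (\<Phi> (Suc l) s x - P l s x) \<le> R l N"
      and R0: "0 \<le> R l N" and l: "Suc l < L" and s: "s \<in> \<Theta> (Suc l + 1)" and n: "n \<le> N"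
    for l s x n
  proof -
    have l': "Suc l \<in> {1..<L}" using l by simp
    note ab = ab[OF l']
    have \<Theta>: "s + real m * \<Delta>T (Suc l) \<in> \<Theta> (Suc l)" if "m < N" for m
      using st l' s that unfolding start_times_def \<Delta>T_def by blast
    have "Suc l + 1 \<in> {1..L}" using l by simp
    then have "{s..s + \<Delta>T (Suc l + 1)} \<subseteq> J"
      using st s unfolding start_times_def \<Delta>T_def by blast
    then have sJ: "s \<in> J" using \<Delta>T[of "Suc l + 1"] by (auto simp: subset_iff)
    have "norm (exact f J s x (s + real n * \<Delta>T (Suc l))
        - parareal (G (Suc l)) (P l) (\<Delta>T (Suc l)) s x (k (Suc l)) n)
      \<le> E_term n n (k (Suc l)) (\<alpha> (Suc l)) (\<beta> (Suc l)) (\<gamma> (Suc l))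
        + R l N * A_factor n (\<beta> (Suc l)) (\<alpha> (Suc l))"
    proof (rule parareal_error[where \<Phi> = "\<Phi> (Suc l)" and N = N and x = x
          and u = "\<lambda>n. exact f J s x (s + real n * \<Delta>T (Suc l))"])
      show "exact f J s x (s + real 0 * \<Delta>T (Suc l)) = x"
        using exact_start[OF wp sJ] by simp
      show "exact f J s x (s + real (Suc m) * \<Delta>T (Suc l))
          = \<Phi> (Suc l) (s + real m * \<Delta>T (Suc l)) (exact f J s x (s + real m * \<Delta>T (Suc l)))"
        if "m < N" for m
        using exact_grid_step[OF wp st _ l' s that] T0 by (simp add: \<Delta>T_def \<Phi>_def)
    qed (use ab R0 n \<Theta> l' cons def lip fine in \<open>simp_all add: \<alpha> \<beta> \<gamma>\<close>)
    also have "\<dots> \<le> R (Suc l) n"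
      unfolding R_Suc using n ab R0
      by (intro add_mono mult_left_mono E_term_mono A_factor_mono) auto
    finally show ?thesis .
  qed
  have R0: "0 \<le> R l N" if "l < L" for l
    using that
  proof (induction l)
    case 0
    then show ?case using \<delta>0 by (simp add: R_def)
  next
    case (Suc l)
    then have "Suc l \<in> {1..<L}" by simp
    note ab = ab[OF this]
    have "0 \<le> E_term N N (k (Suc l)) (\<alpha> (Suc l)) (\<beta> (Suc l)) (\<gamma> (Suc l))"
      using ab by (simp add: E_term_def)
    then show ?case unfolding R_Suc using Suc A_factor_nonneg ab by simp
  qed
  \<comment> \<open>Induction over levels: \<open>N\<close> steps of level \<open>Suc l\<close> make
    up exactly one step of the next level, so \<open>level\<close> at \<open>n = N\<close> bounds
    the error of \<open>P (Suc l)\<close>.\<close>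
  have fine: "norm (\<Phi> (Suc l) s x - P l s x) \<le> R l N"
    if "l < L" "s \<in> \<Theta> (Suc l)" for l s x
    using that
  proof (induction l arbitrary: s x)
    case 0
    then show ?case using fine0 by (simp add: R_def P_def \<delta>)
  next
    case (Suc l)
    have "norm (exact f J s x (s + real N * \<Delta>T (Suc l))
        - parareal (G (Suc l)) (P l) (\<Delta>T (Suc l)) s x (k (Suc l)) N) \<le> R (Suc l) N"
      using Suc R0 by (intro level) auto
    then show ?case
      by (simp add: P_def \<Phi>_def \<Delta>T_def exact_prop_def timestep_Suc[of _ _ "Suc l"])
  qed
  have "ml_error f J \<Theta> N \<Delta>T0 k G P0 n l \<le> ereal (R l n)"
    if l: "l \<in> {1..<L}" and n: "n \<in> {1..N}" for l n
  proof -
    obtain m where m: "l = Suc m" using l by (cases l) auto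
    have "norm (exact f J s x (s + real n * \<Delta>T (Suc m))
        - parareal (G (Suc m)) (P m) (\<Delta>T (Suc m)) s x (k (Suc m)) n) \<le> R (Suc m) n"
      if "s \<in> \<Theta> (Suc m + 1)" for s x
      using l n m that R0 fine by (intro level) auto
    then show ?thesis
      unfolding ml_error_def ml_iterate_def m
      by (intro SUP_least) (auto simp: P_def \<Delta>T_def)
  qed
  moreover have "\<forall>j\<in>{1..<L}. \<alpha> j \<in> {0..\<alpha> j}" using ab by auto
  ultimately show ?thesis unfolding R_def by blast
qed

end
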